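(* Let $\le$ be the product (coordinatewise) order on $\mathbb N^{\mathbb N}$, and let $\le^*$ be the eventual dominance relation on $\mathbb N^{\mathbb N}$. Then $(\mathbb N^{\mathbb N},\le^* )$ is the $\mathrm{proj}$-corrective augmentation of $(\mathbb N^{\mathbb N},\le)$; that is, for all $x,y\in\mathbb N^{\mathbb N}$, $$x\le^* y\iff x\le^{\mathrm{cor}}_{\mathrm{proj}}y .$$
   Context: $\mathbb N=\{0,1,2,\dots\}$ with its usual order; $\mathbb N^{\mathbb N}$ is the set of all functions $\mathbb N\to\mathbb N$. $x\le y$ means $x(n)\le y(n)$ for all $n\in\mathbb N$; $x\le^* y$ means $x(n)\le y(n)$ for all but finitely many $n\in\mathbb N$. For $h:\mathbb N\to\mathbb N$, $\pi_h:\mathbb N^{\mathbb N}\to\mathbb N^{\mathbb N}$ is the map $\pi_h(x)=x\circ h$, and $\mathrm{proj}=\{\pi_h : h:\mathbb N\to\mathbb N\text{ is injective}\}$. For a binary relation $\le$ on a set $S$ and a family $\Theta$ of functions from $S$ to $S$, the $\Theta$-corrective augmentation $\le^{\mathrm{cor}}_{\Theta}$ of $\le$ is defined by: $p\le^{\mathrm{cor}}_{\Theta}q$ if and only if $p\le q$ or for every $\sigma\in\Theta$ there is $\tau\in\Theta$ with $\tau(\sigma(p))\le\tau(\sigma(q))$. *)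

theory Defs
  imports Main
begin

definition eventually_dominated :: "(nat \<Rightarrow> nat) \<Rightarrow> (nat \<Rightarrow> nat) \<Rightarrow> bool"
    (infix "\<le>\<^sup>*" 50) where
  "x \<le>\<^sup>* y \<longleftrightarrow> (\<forall>\<^sub>\<infinity>n. x n \<le> y n)"

definition reindex :: "(nat \<Rightarrow> nat) \<Rightarrow> (nat \<Rightarrow> nat) \<Rightarrow> (nat \<Rightarrow> nat)" where
  "reindex h x = x \<circ> h"

definition proj :: "((nat \<Rightarrow> nat) \<Rightarrow> (nat \<Rightarrow> nat)) set" where
  "proj = {reindex h |h. inj h}"

(* The underlying set S is the whole type 'a, so every \<sigma> :: 'a \<Rightarrow> 'a maps S to S. *)
definition corrective_augmentation ::
    "('a \<Rightarrow> 'a \<Rightarrow> bool) \<Rightarrow> ('a \<Rightarrow> 'a) set \<Rightarrow> 'a \<Rightarrow> 'a \<Rightarrow> bool" where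
  "corrective_augmentation R \<Theta> p q \<longleftrightarrow>
     R p q \<or> (\<forall>\<sigma>\<in>\<Theta>. \<exists>\<tau>\<in>\<Theta>. R (\<tau> (\<sigma> p)) (\<tau> (\<sigma> q)))"

end

theory Submission
  imports Defs
begin

lemma eventually_dominated_iff_finite: "x \<le>\<^sup>* y \<longleftrightarrow> finite {n. \<not> x n \<le> y n}"
  by (simp add: eventually_dominated_def eventually_cofinite)

text \<open>If \<open>x \<le>\<^sup>* y\<close> fails, \<open>\<sigma>\<close> can restrict to the infinite set where \<open>y n < x n\<close>, and no
  further reindexing repairs this. Otherwise only finitely many indices are bad, also after
  composing with an injective \<open>\<sigma>\<close>, and \<open>\<tau>\<close> avoids them.\<close>

theorem theorem3p93:
  fixes x y :: "nat \<Rightarrow> nat"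
  shows "x \<le>\<^sup>* y \<longleftrightarrow> corrective_augmentation (\<le>) proj x y"
proof
  assume dom: "x \<le>\<^sup>* y"
  have "\<exists>\<tau>\<in>proj. \<tau> (\<sigma> x) \<le> \<tau> (\<sigma> y)" if \<sigma>: "\<sigma> \<in> proj" for \<sigma>
  proof -
    obtain h where h: "\<sigma> = reindex h" "inj h"
      using \<sigma> by (auto simp: proj_def)
    \<comment> \<open>This is the set of indices at which \<open>\<sigma> x \<le> \<sigma> y\<close>
      fails; injectivity of \<open>h\<close> keeps it finite.\<close>
    have "finite (h -` {n. \<not> x n \<le> y n})"
      using dom h(2) unfolding eventually_dominated_iff_finite by (rule finite_vimageI)
    then have "infinite (- (h -` {n. \<not> x n \<le> y n}))"
      by (metis finite_compl infinite_UNIV_nat)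
    \<comment> \<open>\<open>k\<close> enumerates without repetition indices that \<open>h\<close>
      sends to good positions; \<open>reindex k\<close> is the witness for
      \<open>\<tau>\<close>.\<close>
    then obtain k :: "nat \<Rightarrow> nat" where k: "inj k" "range k \<subseteq> - (h -` {n. \<not> x n \<le> y n})"
      using infinite_countable_subset by blast
    then have "reindex k (\<sigma> x) \<le> reindex k (\<sigma> y)"
      by (auto simp: h(1) reindex_def le_fun_def)
    moreover have "reindex k \<in> proj"
      using k(1) by (auto simp: proj_def)
    ultimately show ?thesis by blast
  qed
  then show "corrective_augmentation (\<le>) proj x y"
    by (simp add: corrective_augmentation_def)
next
  assume cor: "corrective_augmentation (\<le>) proj x y"
  show "x \<le>\<^sup>* y"
  proof (rule ccontr)
    assume "\<not> x \<le>\<^sup>* y"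
    then have inf: "infinite {n. \<not> x n \<le> y n}"
      by (simp add: eventually_dominated_iff_finite)
    \<comment> \<open>This excludes the first disjunct of \<open>corrective_augmentation\<close>, so
      \<open>cor\<close> must supply a \<open>\<tau>\<close> for every
      \<open>\<sigma>\<close>.\<close>
    then have "\<not> x \<le> y"
      by (auto simp: le_fun_def dest: not_finite_existsD)
    obtain h :: "nat \<Rightarrow> nat" where h: "inj h" "range h \<subseteq> {n. \<not> x n \<le> y n}"
      using inf infinite_countable_subset by blast
    have "reindex h \<in> proj"
      using h(1) by (auto simp: proj_def)
    then obtain \<tau> where "\<tau> \<in> proj" "\<tau> (reindex h x) \<le> \<tau> (reindex h y)"
      using cor \<open>\<not> x \<le> y\<close> by (auto simp: corrective_augmentation_def)
    then obtain k where "reindex k (reindex h x) \<le> reindex k (reindex h y)"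
      by (auto simp: proj_def)
    \<comment> \<open>Every value of \<open>h\<close> is a bad index, so a single coordinate gives
      the contradiction; 0 is an arbitrary choice.\<close>
    then have "x (h (k 0)) \<le> y (h (k 0))"
      by (simp add: reindex_def le_fun_def)
    then show False
      using h(2) by blast
  qed
qed

end
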